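(* Let $B$ be a derivation-finite algebra over a field $\mathbf{k}$. Let $L$ be a Lie subalgebra of $\mathrm{Der}_{\mathbf{k}}(B)$ such that every element of $L$ is a locally nilpotent derivation of $B$. (a) $L$ is locally nil, i.e., for each $D\in L$ the map $\mathrm{ad}(D):L\to L$, $E\mapsto[D,E]$, is locally nilpotent. (b) If $L$ is finite dimensional (over $\mathbf{k}$) then it is a nilpotent Lie algebra.
   Context: An algebra over a field $\mathbf{k}$ is a $\mathbf{k}$-vector space $B$ with an arbitrary $\mathbf{k}$-bilinear multiplication $B\times B\to B$ (not assumed associative, commutative or unital). A $\mathbf{k}$-derivation of $B$ is a $\mathbf{k}$-linear map $D:B\to B$ with $D(x\cdot y)=D(x)\cdot y+x\cdot D(y)$; $\mathrm{Der}_{\mathbf{k}}(B)$ is the Lie algebra of all of them, with bracket $[D,E]=D\circ E-E\circ D$. $B$ is derivation-finite if there exists a finite subset $X$ of $B$ such that any $D\in\mathrm{Der}_{\mathbf{k}}(B)$ with $D(x)=0$ for all $x\in X$ is $D=0$. A linear map $F:V\to V$ is locally nilpotent if for each $x\in V$ there is $n>0$ with $F^n(x)=0$; a derivation is locally nilpotent if it is so as a linear map. A Lie algebra $A$ is nilpotent if there exists $n\ge1$ such that $[x_n,[x_{n-1},\dots,[x_2,x_1]\dots]]=0$ for all $(x_1,\dots,x_n)\in A^n$. *)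

theory Defs
  imports Complex_Main "HOL-Library.Function_Algebras"
begin

text \<open>Not necessarily associative, commutative or unital algebras. The field and the underlying
  space of the algebra are types; endomorphisms carry the pointwise additive structure of
  \<open>Function_Algebras\<close> together with the following pointwise scalar multiplication.\<close>

definition fun_scale :: "('k \<Rightarrow> 'b \<Rightarrow> 'b) \<Rightarrow> 'k \<Rightarrow> ('b \<Rightarrow> 'b) \<Rightarrow> 'b \<Rightarrow> 'b" where
  "fun_scale scale c D = (\<lambda>x. scale c (D x))"

lemma vector_space_fun_scale:
  assumes "vector_space scale"
  shows "vector_space (fun_scale scale)"
proof -
  interpret vector_space scale by (fact assms)
  show ?thesis
    by unfold_locales
      (simp_all add: fun_scale_def fun_eq_iff scale_right_distrib scale_left_distrib)
qed

definition lie_bracket :: "('b::ab_group_add \<Rightarrow> 'b) \<Rightarrow> ('b \<Rightarrow> 'b) \<Rightarrow> 'b \<Rightarrow> 'b" where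
  "lie_bracket D E = (D \<circ> E) - (E \<circ> D)"

definition locally_nilpotent_on :: "'v::zero set \<Rightarrow> ('v \<Rightarrow> 'v) \<Rightarrow> bool" where
  "locally_nilpotent_on V F \<longleftrightarrow> (\<forall>x\<in>V. \<exists>n>0. (F ^^ n) x = 0)"

text \<open>For \<open>xs = [x\<^sub>1, \<dots>, x\<^sub>n]\<close> the term \<open>fold br (tl xs) (hd xs)\<close> is
  \<open>br x\<^sub>n (br x\<^bsub>n-1\<^esub> (\<dots> (br x\<^sub>2 x\<^sub>1)))\<close>.\<close>

definition lie_nilpotent :: "('a::zero \<Rightarrow> 'a \<Rightarrow> 'a) \<Rightarrow> 'a set \<Rightarrow> bool" where
  "lie_nilpotent br A \<longleftrightarrow>
     (\<exists>n\<ge>1. \<forall>xs. length xs = n \<and> set xs \<subseteq> A \<longrightarrow> fold br (tl xs) (hd xs) = 0)"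

locale nonassoc_algebra = vector_space scale
  for scale :: "'k::field \<Rightarrow> 'b::ab_group_add \<Rightarrow> 'b" +
  fixes mult :: "'b \<Rightarrow> 'b \<Rightarrow> 'b"
  assumes linear_mult_right: "Vector_Spaces.linear scale scale (\<lambda>y. mult x y)"
    and linear_mult_left: "Vector_Spaces.linear scale scale (\<lambda>x. mult x y)"
begin

sublocale endo: vector_space "fun_scale scale"
  by (rule vector_space_fun_scale) (fact vector_space_axioms)

definition Der :: "('b \<Rightarrow> 'b) set" where
  "Der = {D. Vector_Spaces.linear scale scale D \<and>
             (\<forall>x y. D (mult x y) = mult (D x) y + mult x (D y))}"

definition derivation_finite :: bool where
  "derivation_finite \<longleftrightarrow>
     (\<exists>X. finite X \<and> (\<forall>D\<in>Der. (\<forall>x\<in>X. D x = 0) \<longrightarrow> D = 0))"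

definition lie_subalgebra_Der :: "('b \<Rightarrow> 'b) set \<Rightarrow> bool" where
  "lie_subalgebra_Der L \<longleftrightarrow>
     L \<subseteq> Der \<and> endo.subspace L \<and> (\<forall>D\<in>L. \<forall>E\<in>L. lie_bracket D E \<in> L)"

definition finite_dimensional :: "('b \<Rightarrow> 'b) set \<Rightarrow> bool" where
  "finite_dimensional L \<longleftrightarrow> (\<exists>S. finite S \<and> S \<subseteq> L \<and> endo.span S = L)"

end

end

theory Submission imports Defs begin

text \<open>
  (a) If \<open>D ^ k\<close> kills \<open>x\<close>, then induction on \<open>k\<close> shows that \<open>ad D ^ n E\<close> kills \<open>x\<close> for all
  large \<open>n\<close>, because \<open>ad D ^ (n + 1) E x = D (ad D ^ n E x) - ad D ^ n E (D x)\<close>. Taking \<open>n\<close> large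
  enough for the finitely many elements of a set on which derivations are determined
  gives \<open>ad D ^ n E = 0\<close>.

  (b) This is Engel's theorem for a Lie algebra \<open>L\<close> whose adjoint maps are locally nilpotent.
  Call a subalgebra \<open>H\<close> good if for all \<open>H\<close>-invariant subspaces \<open>W \<subset> V \<subseteq> L\<close> some
  \<open>v \<in> V - W\<close> satisfies \<open>[H, v] \<subseteq> W\<close>. A good \<open>H \<noteq> L\<close>, applied to \<open>W = H\<close> and \<open>V = L\<close>, is
  normalised by some \<open>z \<in> L - H\<close>, and then \<open>H + k z\<close> is again good; hence a good subalgebra of
  maximal dimension is \<open>L\<close>. Goodness of \<open>L\<close> makes the upper central series grow strictly
  until it reaches \<open>L\<close>.
\<close>

section \<open>Dimension bounds and Lie algebras inside a vector space\<close>

context vector_space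
begin

text \<open>A basis of \<open>U\<close> extends to one of \<open>V\<close>, strictly since
  \<open>U\<close> does not contain \<open>V\<close>, and independence inside \<open>span S\<close>
  bounds its size by \<open>card S\<close>. Strictly growing chains therefore stop.\<close>

lemma dim_psubset_finite_span:
  assumes "finite S" "V \<subseteq> span S" "subspace U" "U \<subset> V"
  shows "dim U < dim V" "dim V \<le> card S"
proof -
  obtain B where B: "B \<subseteq> U" "independent B" "U \<subseteq> span B" "card B = dim U"
    using basis_exists by blast
  obtain C where C: "B \<subseteq> C" "C \<subseteq> V" "independent C" "V \<subseteq> span C"
    using maximal_independent_subset_extend[of B V] B assms(4) by blast
  have fin: "finite C \<and> card C \<le> card S"
    using independent_span_bound[of S C] C assms(1,2) by blast
  have dimV: "dim V = card C"
    using C basis_card_eq_dim by metis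
  have "span B \<subseteq> U"
    using span_minimal[OF B(1) assms(3)] .
  then have "B \<noteq> C"
    using C(4) assms(4) by blast
  then have "card B < card C"
    using C(1) fin by (simp add: psubset_card_mono psubset_eq)
  then show "dim U < dim V" "dim V \<le> card S"
    using B(4) dimV fin by auto
qed

end

text \<open>The identities are demanded only on the carrier \<open>L\<close>, because a commutator
  of arbitrary maps need not be bilinear. The Jacobi identity is written as the Leibniz rule for
  \<open>br x\<close>.\<close>

locale lie_algebra_on = vector_space scale
  for scale :: "'k::field \<Rightarrow> 'v::ab_group_add \<Rightarrow> 'v" +
  fixes L :: "'v set" and br :: "'v \<Rightarrow> 'v \<Rightarrow> 'v"
  assumes subspace_L: "subspace L"
    and br_closed: "x \<in> L \<Longrightarrow> y \<in> L \<Longrightarrow> br x y \<in> L"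
    and br_add_left: "x \<in> L \<Longrightarrow> y \<in> L \<Longrightarrow> z \<in> L \<Longrightarrow> br (x + y) z = br x z + br y z"
    and br_add_right: "x \<in> L \<Longrightarrow> y \<in> L \<Longrightarrow> z \<in> L \<Longrightarrow> br x (y + z) = br x y + br x z"
    and br_scale_left: "x \<in> L \<Longrightarrow> y \<in> L \<Longrightarrow> br (scale c x) y = scale c (br x y)"
    and br_scale_right: "x \<in> L \<Longrightarrow> y \<in> L \<Longrightarrow> br x (scale c y) = scale c (br x y)"
    and br_self: "x \<in> L \<Longrightarrow> br x x = 0"
    and br_jacobi: "x \<in> L \<Longrightarrow> y \<in> L \<Longrightarrow> z \<in> L \<Longrightarrow>
      br x (br y z) = br (br x y) z + br y (br x z)"
begin

lemma zero_mem_L: "0 \<in> L"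
  using subspace_L by (rule subspace_0)

lemma br_zero_left: "y \<in> L \<Longrightarrow> br 0 y = 0"
  using br_scale_left[of 0 y 0] zero_mem_L by simp

lemma br_zero_right: "y \<in> L \<Longrightarrow> br y 0 = 0"
  using br_scale_right[of y 0 0] zero_mem_L by simp

lemma br_antisym:
  assumes "x \<in> L" "y \<in> L"
  shows "br y x = - br x y"
proof -
  have "br (x + y) (x + y) = br x x + br y x + (br x y + br y y)"
    using assms subspace_L by (simp add: br_add_left br_add_right subspace_add)
  then have "br x y + br y x = 0"
    using assms br_self[OF subspace_add[OF subspace_L assms]] by (simp add: br_self add.commute)
  then show ?thesis
    by (simp add: eq_neg_iff_add_eq_0 add.commute)
qed

section \<open>Engel's theorem by enlarging good subalgebras\<close>

definition subalgebra :: "'v set \<Rightarrow> bool" where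
  "subalgebra H \<longleftrightarrow> subspace H \<and> H \<subseteq> L \<and> (\<forall>x\<in>H. \<forall>y\<in>H. br x y \<in> H)"

definition stable :: "'v set \<Rightarrow> 'v set \<Rightarrow> bool" where
  "stable H V \<longleftrightarrow> subspace V \<and> V \<subseteq> L \<and> (\<forall>h\<in>H. \<forall>v\<in>V. br h v \<in> V)"

text \<open>The pair \<open>V\<close>, \<open>W\<close> stands for the nonzero quotient module V/W,
  in which \<open>H\<close> must kill a nonzero vector; no quotient space has to be formed.\<close>

definition engel_good :: "'v set \<Rightarrow> bool" where
  "engel_good H \<longleftrightarrow> subalgebra H \<and>
     (\<forall>V W. stable H V \<longrightarrow> stable H W \<longrightarrow> W \<subset> V \<longrightarrow> (\<exists>v\<in>V - W. \<forall>h\<in>H. br h v \<in> W))"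

lemma engel_goodE:
  assumes "engel_good H" "stable H V" "stable H W" "W \<subset> V"
  obtains v where "v \<in> V" "v \<notin> W" "\<And>h. h \<in> H \<Longrightarrow> br h v \<in> W"
  using assms unfolding engel_good_def by (metis DiffE)

lemma stable_mono: "stable H V \<Longrightarrow> K \<subseteq> H \<Longrightarrow> stable K V"
  unfolding stable_def by blast

lemma engel_good_zero: "engel_good {0}"
proof -
  have "subalgebra {0}"
    by (simp add: subalgebra_def zero_mem_L br_zero_left)
  moreover have "\<exists>v\<in>V - W. \<forall>h\<in>{0}. br h v \<in> W"
    if V: "stable {0} V" and W: "stable {0} W" "W \<subset> V" for V W
  proof -
    obtain v where v: "v \<in> V - W"
      using W(2) by blast
    moreover from v have "br 0 v = 0"
      using V by (intro br_zero_left) (auto simp: stable_def)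
    moreover have "0 \<in> W"
      using W(1) by (simp add: stable_def subspace_0)
    ultimately show ?thesis
      by (intro bexI[of _ v]) simp_all
  qed
  ultimately show ?thesis
    unfolding engel_good_def by blast
qed

lemma subspace_centralizer_mod:
  assumes "subspace V" "V \<subseteq> L" "subspace W" "H \<subseteq> L"
  shows "subspace {v \<in> V. \<forall>h\<in>H. br h v \<in> W}"
proof (rule subspaceI)
  show "0 \<in> {v \<in> V. \<forall>h\<in>H. br h v \<in> W}"
    using assms by (auto simp: subspace_0 br_zero_right subset_iff)
  fix x assume x: "x \<in> {v \<in> V. \<forall>h\<in>H. br h v \<in> W}"
  show "scale c x \<in> {v \<in> V. \<forall>h\<in>H. br h v \<in> W}" for c
    using x assms by (auto simp: subspace_scale br_scale_right subset_iff)
  fix y assume "y \<in> {v \<in> V. \<forall>h\<in>H. br h v \<in> W}"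
  then show "x + y \<in> {v \<in> V. \<forall>h\<in>H. br h v \<in> W}"
    using x assms by (auto simp: subspace_add br_add_right subset_iff)
qed

lemma mem_span_insert_subspace:
  assumes "subspace H" "x \<in> span (insert z H)"
  obtains h c where "h \<in> H" "x = h + scale c z"
proof -
  obtain c where "x - scale c z \<in> span H"
    using assms(2) unfolding span_breakdown_eq by blast
  also have "span H = H"
    using assms(1) by (simp only: span_eq_iff)
  finally show ?thesis
    using that[of "x - scale c z" c] by simp
qed

text \<open>Expanding the bracket of \<open>h + scale c z\<close> and \<open>k + scale d z\<close>,
  the term in \<open>br z z\<close> vanishes and all others lie in \<open>H\<close>.\<close>

lemma subalgebra_span_insert:
  assumes H: "subalgebra H" and z: "z \<in> L" and norm: "\<And>h. h \<in> H \<Longrightarrow> br h z \<in> H"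
  shows "subalgebra (span (insert z H))"
proof -
  have sH: "subspace H" "H \<subseteq> L"
    using H by (auto simp: subalgebra_def)
  have "br x y \<in> span (insert z H)"
    if x: "x \<in> span (insert z H)" and y: "y \<in> span (insert z H)" for x y
  proof -
    obtain h c where x: "h \<in> H" "x = h + scale c z"
      using mem_span_insert_subspace[OF sH(1) x] .
    obtain k d where y: "k \<in> H" "y = k + scale d z"
      using mem_span_insert_subspace[OF sH(1) y] .
    have mem: "h \<in> L" "k \<in> L" "scale c z \<in> L" "scale d z \<in> L"
      using x y sH z subspace_L by (auto simp: subspace_scale)
    have "br x y = br h (k + scale d z) + br (scale c z) (k + scale d z)"
      unfolding x(2) y(2) using mem subspace_L by (intro br_add_left) (simp_all add: subspace_add)
    also have "br h (k + scale d z) = br h k + scale d (br h z)"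
      using mem z by (simp add: br_add_right br_scale_right)
    also have "br (scale c z) (k + scale d z) = scale c (- br k z)"
      using mem z br_antisym[of k z]
      by (simp add: br_add_right br_scale_left br_scale_right br_self)
    finally have "br x y = br h k + scale d (br h z) + scale c (- br k z)" .
    then have "br x y \<in> H"
      using x(1) y(1) norm H sH
      by (simp add: subspace_add subspace_diff subspace_scale subalgebra_def)
    then show ?thesis
      by (simp add: span_base)
  qed
  moreover have "span (insert z H) \<subseteq> L"
    using sH z subspace_L by (intro span_minimal) auto
  ultimately show ?thesis
    by (simp add: subalgebra_def)
qed

text \<open>The vectors of \<open>V\<close> that \<open>H\<close> sends into \<open>W\<close> form a
  set invariant under \<open>br z\<close>. Nilpotency of \<open>br z\<close> finds among them one
  outside \<open>W\<close> that \<open>z\<close> also sends into \<open>W\<close>.\<close>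

lemma engel_good_span_insert:
  assumes H: "engel_good H" and z: "z \<in> L" and norm: "\<And>h. h \<in> H \<Longrightarrow> br h z \<in> H"
    and nil: "locally_nilpotent_on L (br z)"
  shows "engel_good (span (insert z H))"
proof -
  let ?K = "span (insert z H)"
  have saH: "subalgebra H"
    using H by (simp add: engel_good_def)
  then have sH: "subspace H" "H \<subseteq> L"
    by (auto simp: subalgebra_def)
  have HK: "H \<subseteq> ?K" and zK: "z \<in> ?K"
    using span_superset[of "insert z H"] by auto
  have "\<exists>v\<in>V - W. \<forall>x\<in>?K. br x v \<in> W"
    if V: "stable ?K V" and W: "stable ?K W" and WV: "W \<subset> V" for V W
  proof -
    have VL: "V \<subseteq> L" and sW: "subspace W"
      using V W by (auto simp: stable_def)
    define U where "U = {v \<in> V. \<forall>h\<in>H. br h v \<in> W}"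
    obtain u where "u \<in> V" "u \<notin> W" "\<And>h. h \<in> H \<Longrightarrow> br h u \<in> W"
      using engel_goodE[OF H stable_mono[OF V HK] stable_mono[OF W HK] WV] by metis
    then have u: "u \<in> U" "u \<notin> W"
      by (simp_all add: U_def)
    \<comment> \<open>Moving \<open>h\<close> past \<open>z\<close> costs the term
      \<open>br (br h z) v\<close>, harmless because \<open>br h z\<close> lies in
      \<open>H\<close>.\<close>
    have U_step: "br z v \<in> U" if v: "v \<in> U" for v
    proof -
      have vL: "v \<in> L" "v \<in> V"
        using v VL by (auto simp: U_def)
      have "br h (br z v) \<in> W" if h: "h \<in> H" for h
      proof -
        have "br (br h z) v \<in> W" "br z (br h v) \<in> W"
          using v h norm W zK by (auto simp: U_def stable_def)
        moreover have "br h (br z v) = br (br h z) v + br z (br h v)"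
          using h sH z vL by (intro br_jacobi) auto
        ultimately show ?thesis
          using sW by (simp add: subspace_add)
      qed
      then show ?thesis
        using V vL zK by (auto simp: U_def stable_def)
    qed
    have iter: "(br z ^^ n) u \<in> U" for n
      by (induction n) (use u U_step in auto)
    obtain n where "(br z ^^ n) u = 0"
      using nil u VL unfolding locally_nilpotent_on_def U_def by blast
    then have "(br z ^^ n) u \<in> W"
      using sW by (simp add: subspace_0)
    \<comment> \<open>The iterates start outside \<open>W\<close> and end inside, so some step
      \<open>m\<close> crosses over.\<close>
    then obtain m where m: "(br z ^^ m) u \<notin> W" "br z ((br z ^^ m) u) \<in> W"
    proof (induction n)
      case 0
      then show ?case using u by simp
    next
      case (Suc n)
      then show ?case by (cases "(br z ^^ n) u \<in> W") auto
    qed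
    define v where "v = (br z ^^ m) u"
    have v: "v \<in> V - W" "v \<in> L" "br z v \<in> W" "\<And>h. h \<in> H \<Longrightarrow> br h v \<in> W"
      using m iter[of m] VL by (auto simp: v_def U_def)
    have "br x v \<in> W" if x: "x \<in> ?K" for x
    proof -
      obtain h c where x: "h \<in> H" "x = h + scale c z"
        using mem_span_insert_subspace[OF sH(1) x] .
      then have "br x v = br h v + scale c (br z v)"
        using sH z v subspace_L by (subst x(2), subst br_add_left)
          (auto simp: br_scale_left subspace_scale)
      then show ?thesis
        using sW v x(1) by (simp add: subspace_add subspace_scale)
    qed
    then show ?thesis
      using v(1) by blast
  qed
  with subalgebra_span_insert[OF saH z norm] show ?thesis
    by (simp add: engel_good_def)
qed

text \<open>Otherwise every good subalgebra is proper, hence has a good extension of larger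
  dimension. Starting from \<open>{0}\<close> these dimensions would pass the bound
  \<open>card S\<close>.\<close>

lemma engel_good_L:
  assumes S: "finite S" "L \<subseteq> span S"
    and nil: "\<And>x. x \<in> L \<Longrightarrow> locally_nilpotent_on L (br x)"
  shows "engel_good L"
proof (rule ccontr)
  assume notL: "\<not> engel_good L"
  have step: "\<exists>K. engel_good K \<and> dim H < dim K \<and> dim K \<le> card S" if H: "engel_good H" for H
  proof -
    have saH: "subalgebra H"
      using H by (simp add: engel_good_def)
    then have HL: "H \<subset> L"
      using H notL unfolding subalgebra_def by blast
    have "stable H L" "stable H H"
      using saH subspace_L br_closed by (auto simp: stable_def subalgebra_def)
    then obtain z where z: "z \<in> L" "z \<notin> H" "\<And>h. h \<in> H \<Longrightarrow> br h z \<in> H"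
      using engel_goodE[OF H _ _ HL] by metis
    let ?K = "span (insert z H)"
    have good: "engel_good ?K"
      using engel_good_span_insert[OF H z(1,3) nil[OF z(1)]] .
    then have "?K \<subseteq> span S"
      using S by (auto simp: engel_good_def subalgebra_def)
    moreover have "H \<subset> ?K"
      using z(2) span_superset[of "insert z H"] by blast
    moreover have "subspace H"
      using saH by (simp add: subalgebra_def)
    ultimately show ?thesis
      using good dim_psubset_finite_span[OF S(1)] by blast
  qed
  have "\<exists>K. engel_good K \<and> n \<le> dim K" for n
  proof (induction n)
    case 0
    then show ?case using engel_good_zero by blast
  next
    case (Suc n)
    then obtain H where "engel_good H" "n \<le> dim H"
      by blast
    with step[of H] show ?case
      by (metis Suc_leI le_less_trans)
  qed
  then obtain K where "engel_good K" "card S \<le> dim K"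
    by blast
  with step[of K] show False
    by auto
qed

section \<open>The upper central series and nilpotency\<close>

primrec upper_central :: "nat \<Rightarrow> 'v set" where
  "upper_central 0 = {0}"
| "upper_central (Suc n) = {v \<in> L. \<forall>x\<in>L. br x v \<in> upper_central n}"

lemma subspace_upper_central: "subspace (upper_central n)"
  using subspace_centralizer_mod[OF subspace_L order_refl]
  by (induction n) auto

lemma upper_central_subset: "upper_central n \<subseteq> L"
  using zero_mem_L by (cases n) auto

lemma upper_central_mono: "upper_central n \<subseteq> upper_central (Suc n)"
proof (induction n)
  case 0
  then show ?case by (auto simp: zero_mem_L br_zero_right)
next
  case (Suc n)
  then show ?case by auto
qed

text \<open>A member of one term also lies in the next, whose defining condition sends its brackets
  back into the first.\<close>

lemma stable_upper_central: "stable L (upper_central n)"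
  using subspace_upper_central upper_central_subset upper_central_mono[of n]
  unfolding stable_def by auto

text \<open>Each bracket lowers the index by one, down to \<open>upper_central 0\<close>, which is
  zero.\<close>

lemma fold_br_upper_central:
  "set xs \<subseteq> L \<Longrightarrow> v \<in> upper_central (length xs) \<Longrightarrow> fold br xs v = 0"
  by (induction xs arbitrary: v) auto

theorem engel:
  assumes S: "finite S" "L \<subseteq> span S"
    and nil: "\<And>x. x \<in> L \<Longrightarrow> locally_nilpotent_on L (br x)"
  shows "lie_nilpotent br L"
proof -
  have stable_L: "stable L L"
    using subspace_L br_closed by (simp add: stable_def)
  \<comment> \<open>Goodness of \<open>L\<close> is applied with \<open>V = L\<close> and
    \<open>W = upper_central n\<close>; the vector found is new in the next term.\<close>
  have grow: "upper_central n \<subset> upper_central (Suc n)" if "upper_central n \<noteq> L" for n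
  proof -
    have "upper_central n \<subset> L"
      using that upper_central_subset by blast
    then obtain v where "v \<in> L" "v \<notin> upper_central n" "\<And>x. x \<in> L \<Longrightarrow> br x v \<in> upper_central n"
      using engel_goodE[OF engel_good_L[OF S nil] stable_L stable_upper_central] by metis
    then show ?thesis
      using upper_central_mono[of n] by auto
  qed
  have "\<exists>n. upper_central n = L"
  proof (rule ccontr)
    assume *: "\<nexists>n. upper_central n = L"
    have dims: "dim (upper_central n) < dim (upper_central (Suc n))"
      "dim (upper_central (Suc n)) \<le> card S" for n
      using dim_psubset_finite_span[OF S(1) order.trans[OF upper_central_subset S(2)]
          subspace_upper_central grow[of n]] * by simp_all
    have "n \<le> dim (upper_central n)" for n
    proof (induction n)
      case (Suc n)
      then show ?case using dims(1)[of n] by linarith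
    qed simp
    then show False
      using dims(2)[of "card S"] by (metis Suc_n_not_le_n order.trans)
  qed
  then obtain n where n: "upper_central n = L"
    by blast
  \<comment> \<open>The length is \<open>Suc n\<close> because the head only supplies the starting
    vector; the \<open>n\<close> entries of the tail do the bracketing.\<close>
  have "fold br (tl xs) (hd xs) = 0" if "length xs = Suc n" "set xs \<subseteq> L" for xs
    using that n fold_br_upper_central[of "tl xs" "hd xs"] by (cases xs) simp_all
  then have "\<forall>xs. length xs = Suc n \<and> set xs \<subseteq> L \<longrightarrow> fold br (tl xs) (hd xs) = 0"
    by blast
  moreover have "1 \<le> Suc n"
    by simp
  ultimately show ?thesis
    unfolding lie_nilpotent_def by blast
qed

end

section \<open>Pointwise vanishing of iterated commutators\<close>

lemma funpow_lie_bracket_eventually_zero: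
  fixes D E :: "'b::ab_group_add \<Rightarrow> 'b"
  assumes D0: "D 0 = 0" and nil: "locally_nilpotent_on UNIV D"
    and E0: "\<And>n. (lie_bracket D ^^ n) E 0 = 0"
  shows "\<exists>N. \<forall>n\<ge>N. (lie_bracket D ^^ n) E x = 0"
proof -
  have D0': "(D ^^ n) 0 = 0" for n
    by (induction n) (auto simp: D0)
  have nil': "\<exists>n. (D ^^ n) y = 0" for y
    using nil unfolding locally_nilpotent_on_def by blast
  have "(D ^^ k) x = 0 \<Longrightarrow> \<exists>N. \<forall>n\<ge>N. (lie_bracket D ^^ n) E x = 0" for k
  proof (induction k arbitrary: x)
    \<comment> \<open>Here \<open>x = 0\<close>, so the claim is exactly \<open>E0\<close>.\<close>
    case 0
    then show ?case using E0 by simp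
  next
    case (Suc k)
    then have "(D ^^ k) (D x) = 0"
      by (simp add: funpow_swap1)
    then obtain N where N: "\<And>n. n \<ge> N \<Longrightarrow> (lie_bracket D ^^ n) E (D x) = 0"
      using Suc.IH by blast
    \<comment> \<open>From index \<open>N\<close> on the correction term at \<open>D x\<close> is
      gone, so each further commutator just applies \<open>D\<close> to the value at
      \<open>x\<close>.\<close>
    have shift: "(lie_bracket D ^^ (N + j)) E x = (D ^^ j) ((lie_bracket D ^^ N) E x)" for j
    proof (induction j)
      case 0
      then show ?case by simp
    next
      case (Suc j)
      have "(lie_bracket D ^^ (N + Suc j)) E x = D ((lie_bracket D ^^ (N + j)) E x)
          - (lie_bracket D ^^ (N + j)) E (D x)"
        by (simp add: lie_bracket_def)
      then show ?case
        using Suc.IH N[of "N + j"] by simp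
    qed
    obtain m where m: "(D ^^ m) ((lie_bracket D ^^ N) E x) = 0"
      using nil' by blast
    have "(lie_bracket D ^^ n) E x = 0" if "n \<ge> N + m" for n
    proof -
      define i where "i = n - (N + m)"
      have "n = N + (i + m)"
        using that by (simp add: i_def)
      then have "(lie_bracket D ^^ n) E x = (D ^^ i) ((D ^^ m) ((lie_bracket D ^^ N) E x))"
        using shift[of "i + m"] by (simp only: funpow_add o_apply)
      then show ?thesis
        by (simp only: m D0')
    qed
    then show ?case by blast
  qed
  then show ?thesis
    using nil' by blast
qed

section \<open>Lie algebras of derivations\<close>

context nonassoc_algebra
begin

lemma lie_subalgebra_locally_nil:
  assumes fin: derivation_finite and L: "lie_subalgebra_Der L"
    and D: "D \<in> L" "locally_nilpotent_on UNIV D"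
  shows "locally_nilpotent_on L (lie_bracket D)"
proof -
  obtain X where X: "finite X" "\<forall>D\<in>Der. (\<forall>x\<in>X. D x = 0) \<longrightarrow> D = 0"
    using fin unfolding derivation_finite_def by metis
  have zero: "F 0 = 0" if "F \<in> L" for F
  proof -
    interpret F: Vector_Spaces.linear scale scale F
      using that L by (auto simp: lie_subalgebra_Der_def Der_def)
    show ?thesis
      by (fact F.zero)
  qed
  have "\<exists>n>0. (lie_bracket D ^^ n) E = 0" if E: "E \<in> L" for E
  proof -
    have mem: "(lie_bracket D ^^ n) E \<in> L" for n
      by (induction n) (use E D L in \<open>auto simp: lie_subalgebra_Der_def\<close>)
    have "\<exists>N. \<forall>n\<ge>N. (lie_bracket D ^^ n) E x = 0" for x
      using funpow_lie_bracket_eventually_zero[OF zero[OF D(1)] D(2) zero[OF mem]] .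
    then have "\<forall>x. \<exists>N. \<forall>n\<ge>N. (lie_bracket D ^^ n) E x = 0"
      by blast
    from choice[OF this] obtain N where N: "\<And>x n. n \<ge> N x \<Longrightarrow> (lie_bracket D ^^ n) E x = 0"
      by blast
    \<comment> \<open>The sum dominates every \<open>N x\<close> with \<open>x\<close> in
      \<open>X\<close>; \<open>Suc\<close> provides the required positivity.\<close>
    define n where "n = Suc (\<Sum>x\<in>X. N x)"
    have "(lie_bracket D ^^ n) E x = 0" if "x \<in> X" for x
    proof (rule N)
      show "N x \<le> n"
        using member_le_sum[of x X N] that X(1) by (simp add: n_def)
    qed
    moreover have "(lie_bracket D ^^ n) E \<in> Der"
      using mem[of n] L unfolding lie_subalgebra_Der_def by blast
    ultimately have "(lie_bracket D ^^ n) E = 0"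
      using X(2) by simp
    then show ?thesis
      unfolding n_def by blast
  qed
  then show ?thesis
    by (auto simp: locally_nilpotent_on_def)
qed

text \<open>Members of \<open>L\<close> are linear, so the bracket identities follow by expanding
  both sides at a point.\<close>

lemma lie_algebra_on_lie_subalgebra_Der:
  assumes "lie_subalgebra_Der L"
  shows "lie_algebra_on (fun_scale scale) L lie_bracket"
proof -
  have lin: "Vector_Spaces.linear scale scale D" if "D \<in> L" for D
    using that assms by (auto simp: lie_subalgebra_Der_def Der_def)
  have add: "D (x + y) = D x + D y" and diff: "D (x - y) = D x - D y"
    and scl: "D (scale c x) = scale c (D x)" if "D \<in> L" for D x y c
  proof -
    interpret D: Vector_Spaces.linear scale scale D
      using lin[OF that] .
    show "D (x + y) = D x + D y" "D (x - y) = D x - D y" "D (scale c x) = scale c (D x)"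
      by (fact D.add D.diff D.scale)+
  qed
  show ?thesis
  proof
    show "endo.subspace L" "\<And>x y. x \<in> L \<Longrightarrow> y \<in> L \<Longrightarrow> lie_bracket x y \<in> L"
      using assms by (auto simp: lie_subalgebra_Der_def)
  qed (simp_all add: lie_bracket_def fun_eq_iff fun_scale_def add diff scl scale_right_diff_distrib)
qed

end

theorem corollary6p4:
  fixes scale :: "'k::field \<Rightarrow> 'b::ab_group_add \<Rightarrow> 'b"
    and mult :: "'b \<Rightarrow> 'b \<Rightarrow> 'b"
    and L :: "('b \<Rightarrow> 'b) set"
  assumes "nonassoc_algebra scale mult"
    and "nonassoc_algebra.derivation_finite scale mult"
    and "nonassoc_algebra.lie_subalgebra_Der scale mult L"
    and "\<forall>D\<in>L. locally_nilpotent_on UNIV D"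
  shows "(\<forall>D\<in>L. locally_nilpotent_on L (\<lambda>E. lie_bracket D E)) \<and>
         (nonassoc_algebra.finite_dimensional scale L \<longrightarrow> lie_nilpotent lie_bracket L)"
proof -
  interpret nonassoc_algebra scale mult
    by (fact assms(1))
  interpret L: lie_algebra_on "fun_scale scale" L lie_bracket
    using assms(3) by (rule lie_algebra_on_lie_subalgebra_Der)
  have nil: "locally_nilpotent_on L (lie_bracket D)" if "D \<in> L" for D
    using assms(2,3) that bspec[OF assms(4) that] by (rule lie_subalgebra_locally_nil)
  moreover have "lie_nilpotent lie_bracket L" if fin: "finite_dimensional L"
  proof -
    obtain S where "finite S" "endo.span S = L"
      using fin unfolding finite_dimensional_def by blast
    then show ?thesis
      using L.engel[of S] nil by simp
  qed
  ultimately show ?thesis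
    by blast
qed

end
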